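(* Let $\Omega\subset\mathbb{R}^N$ be a bounded domain satisfying the uniform exterior sphere condition, and let $u_0\in C_0(\bar\Omega)$ with $u_0\ge 0$ and $u_0\not\equiv 0$. Let $u$ be the (unique nonnegative) viscosity solution to $$\partial_t u = \Delta_\infty u \ \text{ in } (0,\infty)\times\Omega, \qquad u = 0 \ \text{ on } (0,\infty)\times\partial\Omega, \qquad u(0,x)=u_0(x) \ \text{ for } x\in\bar\Omega .$$ Define $\mathcal{P}_0:=\{x\in\Omega : u_0(x)>0\}$. If $x_0\in\Omega\cap\partial\mathcal{P}_0$ is such that, for some $\delta>0$ and $a>0$, $B(x_0,\delta)\subset\Omega$ and $$u_0(x)\le a\,|x-x_0|^2 \qquad\text{for all } x\in B(x_0,\delta),$$ then there is $\tau(x_0)>0$ such that $u(t,x_0)=0$ for all $t\in[0,\tau(x_0))$.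
   Context: Notation. $B(x,r)=\{y\in\mathbb{R}^N : |y-x|<r\}$; $C_0(\bar\Omega)=\{f\in C(\bar\Omega): f=0 \text{ on }\partial\Omega\}$; $\mathcal{S}(N)$ is the set of symmetric real $N\times N$ matrices; $USC$ and $LSC$ denote upper and lower semicontinuous real-valued functions. The infinity-Laplacian is $\Delta_\infty u = \langle D^2u\,\nabla u,\nabla u\rangle = \sum_{i,j} \frac{\partial^2 u}{\partial x_i\partial x_j}\frac{\partial u}{\partial x_i}\frac{\partial u}{\partial x_j}$. Uniform exterior sphere condition: there is $R>0$ such that for every $x_0\in\partial\Omega$ there is $y_0\in\mathbb{R}^N$ with $|x_0-y_0|=R$ and $B(y_0,R)\cap\Omega=\emptyset$. Parabolic viscosity solutions. Let $Q=(0,\infty)\times\Omega$. For $(t_0,x_0)\in Q$, $\mathcal{P}^{2,+}u(t_0,x_0)$ is the set of $(s,p,X)\in\mathbb{R}\times\mathbb{R}^N\times\mathcal{S}(N)$ such that $u(t,x)\le u(t_0,x_0)+s(t-t_0)+\langle p,x-x_0\rangle+\frac12\langle X(x-x_0),x-x_0\rangle+o(|t-t_0|+|x-x_0|^2)$ as $(t,x)\to(t_0,x_0)$, and $\mathcal{P}^{2,-}u(t_0,x_0)=-\mathcal{P}^{2,+}(-u)(t_0,x_0)$. A function $u\in USC(\bar Q)$ is a viscosity subsolution of the initial-boundary value problem if $s-\langle Xp,p\rangle\le 0$ for all $(s,p,X)\in\mathcal{P}^{2,+}u(t_0,x_0)$ and all $(t_0,x_0)\in Q$, $u\le 0$ on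 $(0,\infty)\times\partial\Omega$, and $u(0,x)\le u_0(x)$ for $x\in\bar\Omega$. A function $u\in LSC(\bar Q)$ is a viscosity supersolution if $s-\langle Xp,p\rangle\ge 0$ for all $(s,p,X)\in\mathcal{P}^{2,-}u(t_0,x_0)$ and all $(t_0,x_0)\in Q$, $u\ge 0$ on $(0,\infty)\times\partial\Omega$, and $u(0,x)\ge u_0(x)$ for $x\in\bar\Omega$. A viscosity solution is a function $u\in C(\bar Q)$ that is both. It is known that, under the stated assumptions on $\Omega$ and $u_0$, there is a unique nonnegative viscosity solution. *)

theory Defs
  imports "HOL-Analysis.Analysis" "HOL-Library.Landau_Symbols"
begin

definition bounded_domain :: "'a::real_normed_vector set \<Rightarrow> bool" where
  "bounded_domain \<Omega> \<longleftrightarrow> open \<Omega> \<and> connected \<Omega> \<and> \<Omega> \<noteq> {} \<and> bounded \<Omega>"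

definition uniform_exterior_sphere :: "'a::real_normed_vector set \<Rightarrow> bool" where
  "uniform_exterior_sphere \<Omega> \<longleftrightarrow>
     (\<exists>R>0. \<forall>x0\<in>frontier \<Omega>. \<exists>y0. dist x0 y0 = R \<and> ball y0 R \<inter> \<Omega> = {})"

(* Functions are total, so membership in one of the following spaces only constrains
   the values on the closed set on which the space lives. *)

definition C_zero :: "'a::topological_space set \<Rightarrow> ('a \<Rightarrow> real) set" where
  "C_zero \<Omega> = {f. continuous_on (closure \<Omega>) f \<and> (\<forall>x\<in>frontier \<Omega>. f x = 0)}"

definition USC :: "'a::topological_space set \<Rightarrow> ('a \<Rightarrow> real) set" where
  "USC S = {f. \<forall>x\<in>S. \<forall>c>f x. \<forall>\<^sub>F y in at x within S. f y < c}"

definition LSC :: "'a::topological_space set \<Rightarrow> ('a \<Rightarrow> real) set" where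
  "LSC S = {f. \<forall>x\<in>S. \<forall>c<f x. \<forall>\<^sub>F y in at x within S. c < f y}"

definition parabolic_cylinder :: "(real ^ 'n) set \<Rightarrow> (real \<times> (real ^ 'n)) set" where
  "parabolic_cylinder \<Omega> = {0<..} \<times> \<Omega>"

(* P^{2,+} u (t0, x0) over the set Q; the o-term of the mathematical definition is
   the existentially quantified remainder r. *)
definition parabolic_superjet ::
    "(real \<times> (real ^ 'n)) set \<Rightarrow> (real \<times> (real ^ 'n) \<Rightarrow> real) \<Rightarrow> real \<times> (real ^ 'n)
      \<Rightarrow> (real \<times> (real ^ 'n) \<times> (real ^ 'n ^ 'n)) set" where
  "parabolic_superjet Q u = (\<lambda>(t0, x0).
     {(s, p, X). transpose X = X \<and>
       (\<exists>r \<in> o[at (t0, x0) within Q](\<lambda>(t, x). \<bar>t - t0\<bar> + (norm (x - x0))\<^sup>2).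
          \<forall>\<^sub>F (t, x) in at (t0, x0) within Q.
            u (t, x) \<le> u (t0, x0) + s * (t - t0) + p \<bullet> (x - x0)
                       + 1 / 2 * ((X *v (x - x0)) \<bullet> (x - x0)) + r (t, x))})"

definition parabolic_subjet ::
    "(real \<times> (real ^ 'n)) set \<Rightarrow> (real \<times> (real ^ 'n) \<Rightarrow> real) \<Rightarrow> real \<times> (real ^ 'n)
      \<Rightarrow> (real \<times> (real ^ 'n) \<times> (real ^ 'n ^ 'n)) set" where
  "parabolic_subjet Q u z = uminus ` parabolic_superjet Q (\<lambda>w. - u w) z"

(* Initial-boundary value problem for the infinity-Laplacian heat equation: a jet
   (s, p, X) stands for (u_t, Du, D^2 u), and (X p) . p for the infinity-Laplacian. *)

definition viscosity_subsolution ::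
    "(real ^ 'n) set \<Rightarrow> (real ^ 'n \<Rightarrow> real) \<Rightarrow> (real \<times> (real ^ 'n) \<Rightarrow> real) \<Rightarrow> bool" where
  "viscosity_subsolution \<Omega> u0 u \<longleftrightarrow>
     u \<in> USC (closure (parabolic_cylinder \<Omega>)) \<and>
     (\<forall>z \<in> parabolic_cylinder \<Omega>. \<forall>(s, p, X) \<in> parabolic_superjet (parabolic_cylinder \<Omega>) u z.
        s - (X *v p) \<bullet> p \<le> 0) \<and>
     (\<forall>t>0. \<forall>x\<in>frontier \<Omega>. u (t, x) \<le> 0) \<and>
     (\<forall>x\<in>closure \<Omega>. u (0, x) \<le> u0 x)"

definition viscosity_supersolution ::
    "(real ^ 'n) set \<Rightarrow> (real ^ 'n \<Rightarrow> real) \<Rightarrow> (real \<times> (real ^ 'n) \<Rightarrow> real) \<Rightarrow> bool" where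
  "viscosity_supersolution \<Omega> u0 u \<longleftrightarrow>
     u \<in> LSC (closure (parabolic_cylinder \<Omega>)) \<and>
     (\<forall>z \<in> parabolic_cylinder \<Omega>. \<forall>(s, p, X) \<in> parabolic_subjet (parabolic_cylinder \<Omega>) u z.
        s - (X *v p) \<bullet> p \<ge> 0) \<and>
     (\<forall>t>0. \<forall>x\<in>frontier \<Omega>. u (t, x) \<ge> 0) \<and>
     (\<forall>x\<in>closure \<Omega>. u (0, x) \<ge> u0 x)"

definition viscosity_solution ::
    "(real ^ 'n) set \<Rightarrow> (real ^ 'n \<Rightarrow> real) \<Rightarrow> (real \<times> (real ^ 'n) \<Rightarrow> real) \<Rightarrow> bool" where
  "viscosity_solution \<Omega> u0 u \<longleftrightarrow>
     continuous_on (closure (parabolic_cylinder \<Omega>)) u \<and>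
     viscosity_subsolution \<Omega> u0 u \<and> viscosity_supersolution \<Omega> u0 u"

end

theory Submission
  imports Defs
begin

text \<open>
  The function \<open>(A + 64 A\<^sup>3 t) |x - x0|\<^sup>2\<close> is a supersolution as long as \<open>64 A\<^sup>2 t \<le> 1\<close>: the
  infinity-Laplacian of \<open>f(t) |x - x0|\<^sup>2\<close> is \<open>8 f(t)\<^sup>3 |x - x0|\<^sup>2\<close>, and \<open>f \<le> 2 A\<close>. Choosing \<open>A\<close>
  large makes it dominate \<open>u\<close> on the parabolic boundary of a small cylinder around \<open>x0\<close>. The extra
  term \<open>\<epsilon> / (T - t)\<close> makes the supersolution strict (also at \<open>x0\<close>, where the gradient vanishes)
  and keeps a contact point away from the final time, so that comparison with \<open>u\<close> only needs the
  definition of a viscosity subsolution. Letting \<open>\<epsilon>\<close> tend to \<open>0\<close> gives \<open>u(t, x0) \<le> 0\<close>.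
\<close>

lemma mat_scaleR_vector: "mat c *v v = c *\<^sub>R v" for v :: "real ^ 'n"
  by (simp add: vec_eq_iff matrix_vector_mult_def mat_def if_distrib if_distribR cong: if_cong)

text \<open>The factor \<open>t - t1\<close> is already controlled by the first summand of the
  parabolic gauge, so any multiplier tending to 0 suffices, with no rate.\<close>

lemma smallo_parabolic_remainder:
  fixes g :: "real \<times> (real ^ 'n) \<Rightarrow> real"
  assumes "(g \<longlongrightarrow> 0) (at (t1, x1) within Q)"
  shows "(\<lambda>(t, x). (t - t1) * g (t, x))
           \<in> o[at (t1, x1) within Q](\<lambda>(t, x). \<bar>t - t1\<bar> + (norm (x - x1))\<^sup>2)"
proof (rule landau_o.smallI)
  fix c :: real assume c: "c > 0"
  have "\<forall>\<^sub>F z in at (t1, x1) within Q. \<bar>g z\<bar> < c"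
    using tendstoD[OF assms c] by (simp add: dist_real_def)
  then show "\<forall>\<^sub>F z in at (t1, x1) within Q. norm (case z of (t, x) \<Rightarrow> (t - t1) * g (t, x))
      \<le> c * norm (case z of (t, x) \<Rightarrow> \<bar>t - t1\<bar> + (norm (x - x1))\<^sup>2)"
  proof eventually_elim
    case (elim z)
    obtain t x where z: "z = (t, x)" by force
    have "\<bar>t - t1\<bar> * \<bar>g z\<bar> \<le> \<bar>t - t1\<bar> * c"
      using elim by (intro mult_left_mono) auto
    also have "\<dots> \<le> c * (\<bar>t - t1\<bar> + (norm (x - x1))\<^sup>2)"
      using c by (simp add: algebra_simps)
    finally show ?case by (simp add: z abs_mult)
  qed
qed

text \<open>The barrier is quadratic in space, so its second-order expansion at the contact point is
  exact up to terms carrying a factor \<open>t - t1\<close>. A local maximum of the difference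
  transfers this expansion to \<open>u\<close>.\<close>

lemma barrier_touching_superjet:
  fixes u :: "real \<times> (real ^ 'n) \<Rightarrow> real" and x0 x1 :: "real ^ 'n"
  assumes t1: "t1 < T"
    and touch: "\<forall>\<^sub>F (t, x) in at (t1, x1) within Q.
      u (t, x) - ((A + B * t) * (norm (x - x0))\<^sup>2 + e / (T - t))
        \<le> u (t1, x1) - ((A + B * t1) * (norm (x1 - x0))\<^sup>2 + e / (T - t1))"
  shows "(B * (norm (x1 - x0))\<^sup>2 + e / (T - t1)\<^sup>2, (2 * (A + B * t1)) *\<^sub>R (x1 - x0),
           mat (2 * (A + B * t1))) \<in> parabolic_superjet Q u (t1, x1)"
proof -
  define y where "y = x1 - x0"
  define f where "f = A + B * t1"
  \<comment> \<open>Exact remainder divided by \<open>t - t1\<close>: the first summand pairs the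
    growth \<open>B\<close> of the coefficient with the increment of the squared distance, the
    second is what linearising \<open>e / (T - t)\<close> leaves over.\<close>
  define g where "g = (\<lambda>(t, x). B * (2 * (y \<bullet> (x - x1)) + (norm (x - x1))\<^sup>2)
                        + e * (t - t1) / ((T - t) * (T - t1)\<^sup>2))"
  have cont: "continuous (at (t1, x1)) g"
    unfolding g_def case_prod_unfold using t1
    by (intro continuous_intros) auto
  have "g (t1, x1) = 0" by (simp add: g_def)
  with cont have "(g \<longlongrightarrow> 0) (at (t1, x1) within Q)"
    using continuous_at_imp_continuous_at_within continuous_within by metis
  note small = smallo_parabolic_remainder[OF this]
  have ev: "\<forall>\<^sub>F z in at (t1, x1) within Q. fst z < T"
    by (rule order_tendstoD(2)[OF _ t1]) (auto intro!: tendsto_eq_intros)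
  have ident: "(A + B * t) * (norm (x - x0))\<^sup>2 + e / (T - t) - (f * (norm y)\<^sup>2 + e / (T - t1))
      = (B * (norm y)\<^sup>2 + e / (T - t1)\<^sup>2) * (t - t1) + (2 * f) *\<^sub>R y \<bullet> (x - x1)
        + 1 / 2 * ((mat (2 * f) *v (x - x1)) \<bullet> (x - x1)) + (t - t1) * g (t, x)"
    if "t < T" for t x
  proof -
    define h where "h = x - x1"
    have "x - x0 = y + h" by (simp add: y_def h_def)
    then have sq: "(norm (x - x0))\<^sup>2 = (norm y)\<^sup>2 + 2 * (y \<bullet> h) + (norm h)\<^sup>2"
      by (simp add: power2_norm_eq_inner inner_add_left inner_add_right inner_commute)
    have frac: "e / (T - t) - e / (T - t1)
        = e / (T - t1)\<^sup>2 * (t - t1) + (t - t1) * (e * (t - t1) / ((T - t) * (T - t1)\<^sup>2))"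
    proof -
      define p q where "p = T - t" and "q = T - t1"
      have nz: "p \<noteq> 0" "q \<noteq> 0" and eq: "t - t1 = q - p"
        using that t1 by (auto simp: p_def q_def)
      show ?thesis
        unfolding p_def[symmetric] q_def[symmetric] eq
        using nz by (simp add: field_simps power2_eq_square)
    qed
    have "1 / 2 * ((mat (2 * f) *v h) \<bullet> h) = f * (norm h)\<^sup>2"
      by (simp add: mat_scaleR_vector power2_norm_eq_inner)
    moreover have "(A + B * t) * (norm (x - x0))\<^sup>2 - f * (norm y)\<^sup>2
        = B * (norm y)\<^sup>2 * (t - t1) + (2 * f) *\<^sub>R y \<bullet> h + f * (norm h)\<^sup>2
          + (t - t1) * (B * (2 * (y \<bullet> h) + (norm h)\<^sup>2))"
      unfolding sq f_def by (simp add: algebra_simps)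
    ultimately show ?thesis
      using frac unfolding g_def prod.case h_def[symmetric] distrib_left distrib_right
      by linarith
  qed
  have "\<forall>\<^sub>F (t, x) in at (t1, x1) within Q.
      u (t, x) \<le> u (t1, x1) + (B * (norm y)\<^sup>2 + e / (T - t1)\<^sup>2) * (t - t1)
        + (2 * f) *\<^sub>R y \<bullet> (x - x1) + 1 / 2 * ((mat (2 * f) *v (x - x1)) \<bullet> (x - x1))
        + (t - t1) * g (t, x)"
    using touch ev
  proof eventually_elim
    case (elim z)
    obtain t x where z: "z = (t, x)" by force
    then have "t < T" using elim by simp
    from ident[OF this, of x] elim show ?case
      unfolding z prod.case f_def[symmetric] y_def[symmetric] by linarith
  qed
  moreover have "transpose (mat (2 * f) :: real ^ 'n ^ 'n) = mat (2 * f)"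
    by (simp add: transpose_mat)
  ultimately show ?thesis
    unfolding parabolic_superjet_def f_def[symmetric] y_def[symmetric] prod.case mem_Collect_eq
    by (intro conjI rev_bexI[OF small]) simp_all
qed

lemma viscosity_subsolution_less_barrier:
  fixes u :: "real \<times> (real ^ 'n) \<Rightarrow> real"
  assumes sub: "viscosity_subsolution \<Omega> u0 u"
    and cont: "continuous_on ({0..T} \<times> cball x0 \<rho>) u"
    and ball: "cball x0 \<rho> \<subseteq> \<Omega>"
    and A: "A > 0" and T: "64 * A\<^sup>2 * T \<le> 1" and e: "e > 0"
    and M: "\<And>z. z \<in> {0..T} \<times> cball x0 \<rho> \<Longrightarrow> u z \<le> M" and M0: "M \<ge> 0"
    and lateral: "M \<le> A * \<rho>\<^sup>2"
    and initial: "\<And>x. x \<in> cball x0 \<rho> \<Longrightarrow> u0 x \<le> A * (norm (x - x0))\<^sup>2"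
    and t: "0 \<le> t" "t < T" and x: "x \<in> cball x0 \<rho>"
  shows "u (t, x) < (A + 64 * A ^ 3 * t) * (norm (x - x0))\<^sup>2 + e / (T - t)"
proof (rule ccontr)
  define B where "B = 64 * A ^ 3"
  define w where "w = (\<lambda>(t, x). u (t, x) - ((A + B * t) * (norm (x - x0))\<^sup>2 + e / (T - t)))"
  assume "\<not> ?thesis"
  then have w0: "w (t, x) \<ge> 0" by (simp add: w_def B_def)
  \<comment> \<open>From time \<open>T - e / (M + 1)\<close> on, the penalty is at least
    \<open>M + 1\<close> and exceeds \<open>u\<close>. The maximum with \<open>t\<close> keeps the
    supposed bad point in \<open>K\<close>, and \<open>S < T\<close> avoids the singularity.\<close>
  define S where "S = max t (T - e / (M + 1))"
  define K where "K = {0..S} \<times> cball x0 \<rho>"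
  have B: "B > 0" using A by (simp add: B_def)
  have S: "S < T" "t \<le> S" using t e M0 by (auto simp: S_def)
  have KT: "K \<subseteq> {0..T} \<times> cball x0 \<rho>" using S by (auto simp: K_def)
  have "continuous_on K w"
    unfolding w_def case_prod_unfold prod.collapse
    using S by (intro continuous_intros continuous_on_subset[OF cont KT]) (auto simp: K_def)
  moreover have "compact K" by (simp add: K_def compact_Times)
  moreover have tx: "(t, x) \<in> K" using t S x by (auto simp: K_def)
  ultimately obtain z1 where z1: "z1 \<in> K" "\<And>z. z \<in> K \<Longrightarrow> w z \<le> w z1"
    using continuous_attains_sup[of K w] by blast
  obtain t1 x1 where z1_eq: "z1 = (t1, x1)" by force
  have w1: "w (t1, x1) \<ge> 0" using w0 z1(2)[OF tx] z1_eq by simp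
  have t1: "0 \<le> t1" "t1 \<le> S" "t1 < T" and x1: "x1 \<in> cball x0 \<rho>"
    using z1(1) S by (auto simp: K_def z1_eq)
  have u1: "u (t1, x1) \<le> M" using M z1(1) KT z1_eq by blast
  have pen: "e / (T - t1) > 0" using t1 e by simp
  \<comment> \<open>Dropping the nonnegative growth term and the positive penalty gives the strict
    inequality that excludes both the initial time and the lateral boundary.\<close>
  have "A * (norm (x1 - x0))\<^sup>2 \<le> (A + B * t1) * (norm (x1 - x0))\<^sup>2"
    using B t1 by (intro mult_right_mono) auto
  with w1 pen have u1_gt: "u (t1, x1) > A * (norm (x1 - x0))\<^sup>2"
    by (simp add: w_def)
  have "t1 \<noteq> 0"
  proof
    assume "t1 = 0"
    moreover have "u (0, x1) \<le> u0 x1"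
      using sub subsetD[OF closure_subset subsetD[OF ball x1]]
      unfolding viscosity_subsolution_def by blast
    ultimately show False using initial[OF x1] u1_gt by simp
  qed
  with t1 have t1_pos: "t1 > 0" by simp
  have "norm (x1 - x0) \<noteq> \<rho>"
    using u1_gt u1 lateral by auto
  then have x1_ball: "x1 \<in> ball x0 \<rho>"
    using x1 by (auto simp: dist_norm norm_minus_commute)
  have "t1 \<noteq> S"
  proof
    assume "t1 = S"
    then have "T - t1 \<le> e / (M + 1)" by (simp add: S_def)
    then have "M + 1 \<le> e / (T - t1)"
      using t1 M0 by (simp add: field_simps)
    moreover have "0 \<le> (A + B * t1) * (norm (x1 - x0))\<^sup>2" using A B t1 by simp
    ultimately show False using w1 u1 by (simp add: w_def)
  qed
  with t1 have t1_S: "t1 < S" by simp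
  define Q where "Q = parabolic_cylinder \<Omega>"
  have nbhd: "open ({0<..<S} \<times> ball x0 \<rho>)" "(t1, x1) \<in> {0<..<S} \<times> ball x0 \<rho>"
    using t1_pos t1_S x1_ball by (auto intro: open_Times)
  \<comment> \<open>The maximum point over \<open>K\<close> avoids its boundary, so it is a local
    maximum relative to all of \<open>Q\<close>.\<close>
  have "\<forall>\<^sub>F z in at (t1, x1) within Q. z \<in> {0<..<S} \<times> ball x0 \<rho>"
    using topological_tendstoD[OF tendsto_ident_at nbhd] .
  then have "\<forall>\<^sub>F z in at (t1, x1) within Q. w z \<le> w (t1, x1)"
    by eventually_elim (use z1 z1_eq in \<open>auto simp: K_def\<close>)
  then have touch: "\<forall>\<^sub>F (t, x) in at (t1, x1) within Q.
      u (t, x) - ((A + B * t) * (norm (x - x0))\<^sup>2 + e / (T - t))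
        \<le> u (t1, x1) - ((A + B * t1) * (norm (x1 - x0))\<^sup>2 + e / (T - t1))"
    by (simp add: w_def case_prod_unfold)
  define f where "f = A + B * t1"
  define d where "d = (norm (x1 - x0))\<^sup>2"
  have "(t1, x1) \<in> Q"
    using t1_pos x1 ball by (auto simp: Q_def parabolic_cylinder_def)
  with barrier_touching_superjet[OF \<open>t1 < T\<close> touch] sub
  have "B * d + e / (T - t1)\<^sup>2
      \<le> (mat (2 * f) *v ((2 * f) *\<^sub>R (x1 - x0))) \<bullet> ((2 * f) *\<^sub>R (x1 - x0))"
    unfolding viscosity_subsolution_def Q_def[symmetric] f_def d_def by fastforce
  then have "B * d + e / (T - t1)\<^sup>2 \<le> 8 * f ^ 3 * d"
    by (simp add: d_def mat_scaleR_vector power2_norm_eq_inner power3_eq_cube algebra_simps)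
  \<comment> \<open>The time restriction gives \<open>f \<le> 2 * A\<close>, hence
    \<open>8 * f ^ 3 \<le> 64 * A ^ 3\<close>; this is where the value of \<open>B\<close> comes
    from.\<close>
  moreover have "8 * f ^ 3 * d \<le> B * d"
  proof -
    have "64 * A\<^sup>2 * t1 \<le> 64 * A\<^sup>2 * T" using t1 by (intro mult_left_mono) auto
    then have "64 * A\<^sup>2 * t1 \<le> 1" using T by linarith
    then have "A * (64 * A\<^sup>2 * t1) \<le> A * 1" using A by (intro mult_left_mono) auto
    then have "f \<le> 2 * A" by (simp add: f_def B_def power2_eq_square power3_eq_cube algebra_simps)
    moreover have "0 \<le> f" using A B t1 by (simp add: f_def)
    ultimately have "f ^ 3 \<le> (2 * A) ^ 3" by (intro power_mono)
    then show ?thesis by (intro mult_right_mono) (auto simp: B_def d_def power_mult_distrib)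
  qed
  \<comment> \<open>The derivative of the penalty yields the contradiction even when
    \<open>d = 0\<close>.\<close>
  moreover have "e / (T - t1)\<^sup>2 > 0" using t1 e by simp
  ultimately show False by linarith
qed

theorem proposition4p2:
  fixes \<Omega> :: "(real ^ 'n) set" and u0 :: "real ^ 'n \<Rightarrow> real"
    and u :: "real \<times> (real ^ 'n) \<Rightarrow> real" and x0 :: "real ^ 'n"
  assumes "bounded_domain \<Omega>"
    and "uniform_exterior_sphere \<Omega>"
    and "u0 \<in> C_zero \<Omega>"
    and "\<forall>x\<in>closure \<Omega>. u0 x \<ge> 0"
    and "\<exists>x\<in>closure \<Omega>. u0 x \<noteq> 0"
    and "viscosity_solution \<Omega> u0 u"
    and "\<forall>z\<in>closure (parabolic_cylinder \<Omega>). u z \<ge> 0"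
    and "x0 \<in> \<Omega> \<inter> frontier {x\<in>\<Omega>. u0 x > 0}"
    and "\<exists>\<delta>>0. \<exists>a>0. ball x0 \<delta> \<subseteq> \<Omega> \<and> (\<forall>x\<in>ball x0 \<delta>. u0 x \<le> a * (norm (x - x0))\<^sup>2)"
  shows "\<exists>\<tau>>0. \<forall>t\<in>{0..<\<tau>}. u (t, x0) = 0"
proof -
  obtain \<delta> a where \<delta>: "\<delta> > 0" and a: "a > 0" and ball: "ball x0 \<delta> \<subseteq> \<Omega>"
    and u0: "\<forall>x\<in>ball x0 \<delta>. u0 x \<le> a * (norm (x - x0))\<^sup>2"
    using assms(9) by blast
  \<comment> \<open>Halving the radius puts a closed, hence compact, ball inside the ball of the
    hypothesis.\<close>
  define \<rho> where "\<rho> = \<delta> / 2"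
  have \<rho>: "\<rho> > 0" "cball x0 \<rho> \<subseteq> ball x0 \<delta>"
    using \<delta> by (auto simp: \<rho>_def)
  have clQ: "closure (parabolic_cylinder \<Omega>) = {0..} \<times> closure \<Omega>"
    by (simp add: parabolic_cylinder_def closure_Times)
  have KQ: "{0..1} \<times> cball x0 \<rho> \<subseteq> closure (parabolic_cylinder \<Omega>)"
    unfolding clQ using \<rho>(2) ball closure_subset by fastforce
  have sub: "viscosity_subsolution \<Omega> u0 u"
    and contQ: "continuous_on (closure (parabolic_cylinder \<Omega>)) u"
    using assms(6) by (auto simp: viscosity_solution_def)
  have cont: "continuous_on ({0..1} \<times> cball x0 \<rho>) u"
    using continuous_on_subset[OF contQ KQ] .
  have "compact (u ` ({0..1} \<times> cball x0 \<rho>))"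
    using compact_continuous_image[OF cont] by (simp add: compact_Times)
  then obtain M where M: "M > 0" "\<And>z. z \<in> {0..1} \<times> cball x0 \<rho> \<Longrightarrow> \<bar>u z\<bar> \<le> M"
    using compact_imp_bounded bounded_pos by (metis imageI real_norm_def)
  \<comment> \<open>The bound \<open>a\<close> serves the initial comparison,
    \<open>M / \<rho>\<^sup>2\<close> the lateral one.\<close>
  define A where "A = max a (M / \<rho>\<^sup>2)"
  have A: "A > 0" "a \<le> A" "M \<le> A * \<rho>\<^sup>2"
    using a \<rho> M(1) by (auto simp: A_def max_def field_simps)
  \<comment> \<open>The cap 1 keeps the cylinder where \<open>M\<close> bounds \<open>u\<close>; the
    other term is the lifespan of the barrier.\<close>
  define T where "T = min 1 (1 / (64 * A\<^sup>2))"
  have T: "T > 0" "T \<le> 1" "64 * A\<^sup>2 * T \<le> 1"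
    using A by (auto simp: T_def min_def field_simps)
  have KT: "{0..T} \<times> cball x0 \<rho> \<subseteq> {0..1} \<times> cball x0 \<rho>" using T by auto
  have initial: "u0 x \<le> A * (norm (x - x0))\<^sup>2" if "x \<in> cball x0 \<rho>" for x
  proof -
    have "u0 x \<le> a * (norm (x - x0))\<^sup>2" using u0 \<rho>(2) that by blast
    also have "\<dots> \<le> A * (norm (x - x0))\<^sup>2" using A by (intro mult_right_mono) auto
    finally show ?thesis .
  qed
  have "u (t, x0) = 0" if t: "t \<in> {0..<T}" for t
  proof (rule antisym)
    show "u (t, x0) \<le> 0"
    proof (rule field_le_epsilon)
      fix e :: real assume e: "e > 0"
      \<comment> \<open>At the centre the quadratic term vanishes; taking \<open>e * (T - t)\<close>
        as the penalty weight leaves exactly \<open>e\<close>.\<close>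
      have "u (t, x0) < (A + 64 * A ^ 3 * t) * (norm (x0 - x0))\<^sup>2 + e * (T - t) / (T - t)"
        using \<rho> ball A T t e M(1) order_trans[OF abs_ge_self M(2)[OF subsetD[OF KT]]]
        by (intro viscosity_subsolution_less_barrier[OF sub continuous_on_subset[OF cont KT],
              where M = M] initial) auto
      then show "u (t, x0) \<le> 0 + e" using t by simp
    qed
    have "(t, x0) \<in> {0..T} \<times> cball x0 \<rho>" using t \<rho>(1) by simp
    then show "u (t, x0) \<ge> 0"
      using assms(7) KQ KT by blast
  qed
  with T show ?thesis by blast
qed

end
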